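(* Let $r\ge1$, $\Lambda=\mathbb Q[t_1^{\pm1},\dots,t_r^{\pm1}]$ and $P=\mathbb Q[t_1,\dots,t_r]\subset\Lambda$. Let $E\subset\Lambda$ be any ideal, put $J:=E\cap P$, and let $\mathcal G$ be the reduced Gröbner basis of $J$. The following are equivalent. (i) $\overline E=E$. (ii) $g^\vee\in J$ for every $g\in\mathcal G$. (iii) $\operatorname{NF}_{\mathcal G}(g^\vee)=0$ for every $g\in\mathcal G$, where $\operatorname{NF}_{\mathcal G}$ denotes the normal form with respect to $\mathcal G$.
   Context: The involution of $\Lambda$ is the $\mathbb Q$-algebra map with $\overline{t_i}=t_i^{-1}$, and $\overline E=\{\overline f\mid f\in E\}$. Gröbner bases and normal forms in $P$ are taken with respect to the lexicographic order $t_1>\cdots>t_r$ (the zero ideal has empty reduced Gröbner basis, the unit ideal has $\{1\}$). For $0\neq g\in P$, its polynomial reciprocal is $g^\vee:=t_1^{\deg_{t_1}g}\cdots t_r^{\deg_{t_r}g}\,g(t_1^{-1},\dots,t_r^{-1})\in P$. *)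

theory Defs
  imports Complex_Main "HOL-Library.Poly_Mapping"
begin

text \<open>
  The variables \<open>t\<^sub>1, \<dots>, t\<^sub>r\<close> are indexed by a finite linearly ordered type \<open>'n\<close>, so \<open>r = CARD('n) \<ge> 1\<close>.
  Multiplication on \<open>\<Rightarrow>\<^sub>0\<close> is convolution, so the types below are the rings
  \<open>P = \<rat>[t\<^sub>1, \<dots>, t\<^sub>r]\<close> and \<open>\<Lambda> = \<rat>[t\<^sub>1\<^sup>\<plusminus>\<^sup>1, \<dots>, t\<^sub>r\<^sup>\<plusminus>\<^sup>1]\<close>, with exponent vectors as keys.
\<close>

type_synonym 'n poly_ring = "('n \<Rightarrow>\<^sub>0 nat) \<Rightarrow>\<^sub>0 rat"
type_synonym 'n laurent_ring = "('n \<Rightarrow>\<^sub>0 int) \<Rightarrow>\<^sub>0 rat"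

text \<open>Ideals of a commutative ring are its submodules as a module over itself.\<close>

global_interpretation ring_ideal: module "(*) :: 'a::comm_ring_1 \<Rightarrow> 'a \<Rightarrow> 'a"
  by unfold_locales (simp_all add: algebra_simps)

abbreviation is_ideal :: "'a::comm_ring_1 set \<Rightarrow> bool"
  where "is_ideal \<equiv> ring_ideal.subspace"

abbreviation ideal_generated :: "'a::comm_ring_1 set \<Rightarrow> 'a set"
  where "ideal_generated \<equiv> ring_ideal.span"

text \<open>The linear map sending the monomial with exponent \<open>m\<close> to the one with exponent \<open>\<phi> m\<close>;
  a ring homomorphism when \<open>\<phi>\<close> is additive.\<close>

definition map_exponents :: "('a \<Rightarrow> 'b) \<Rightarrow> ('a \<Rightarrow>\<^sub>0 'c) \<Rightarrow> ('b \<Rightarrow>\<^sub>0 'c::comm_monoid_add)"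
  where "map_exponents \<phi> p = (\<Sum>m\<in>Poly_Mapping.keys p. Poly_Mapping.single (\<phi> m) (Poly_Mapping.lookup p m))"

lemma map_exponents_superset:
  assumes "finite S" "Poly_Mapping.keys p \<subseteq> S"
  shows "map_exponents \<phi> p = (\<Sum>m\<in>S. Poly_Mapping.single (\<phi> m) (Poly_Mapping.lookup p m))"
  unfolding map_exponents_def
  by (rule sum.mono_neutral_left) (use assms in \<open>auto simp: in_keys_iff\<close>)

lemma map_exponents_zero [simp]: "map_exponents \<phi> 0 = 0"
  by (simp add: map_exponents_def)

lemma map_exponents_single [simp]:
  "map_exponents \<phi> (Poly_Mapping.single m c) = Poly_Mapping.single (\<phi> m) c"
  by (simp add: map_exponents_def)

lemma map_exponents_add: "map_exponents \<phi> (p + q) = map_exponents \<phi> p + map_exponents \<phi> q"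
proof -
  let ?S = "Poly_Mapping.keys p \<union> Poly_Mapping.keys q"
  have "Poly_Mapping.keys (p + q) \<subseteq> ?S" by (rule keys_add)
  then show ?thesis
    by (simp add: map_exponents_superset[of ?S] lookup_add single_add sum.distrib)
qed

lemma map_exponents_sum: "map_exponents \<phi> (\<Sum>x\<in>A. f x) = (\<Sum>x\<in>A. map_exponents \<phi> (f x))"
  by (induction A rule: infinite_finite_induct) (simp_all add: map_exponents_add)

lemma map_exponents_id: "map_exponents (\<lambda>m. m) p = p"
proof (rule poly_mapping_eqI)
  fix k
  show "Poly_Mapping.lookup (map_exponents (\<lambda>m. m) p) k = Poly_Mapping.lookup p k"
    by (auto simp: map_exponents_def lookup_sum lookup_single when_def in_keys_iff
        sum.delta if_distrib cong: if_cong)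
qed

lemma map_exponents_map_exponents:
  "map_exponents \<phi> (map_exponents \<psi> p) = map_exponents (\<lambda>m. \<phi> (\<psi> m)) p"
  by (subst (2) map_exponents_def) (simp add: map_exponents_sum, simp add: map_exponents_def)

lemma map_exponents_mult:
  fixes p q :: "'a::monoid_add \<Rightarrow>\<^sub>0 'c::semiring_0"
    and \<phi> :: "'a \<Rightarrow> 'b::monoid_add"
  assumes "\<And>m k. \<phi> (m + k) = \<phi> m + \<phi> k"
  shows "map_exponents \<phi> (p * q) = map_exponents \<phi> p * map_exponents \<phi> q"
proof -
  have "p * q = map_exponents (\<lambda>m. m) p * map_exponents (\<lambda>m. m) q"
    by (simp add: map_exponents_id)
  also have "map_exponents \<phi> \<dots> = map_exponents \<phi> p * map_exponents \<phi> q"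
    by (simp add: map_exponents_def[of _ p] map_exponents_def[of _ q] sum_product
        map_exponents_sum mult_single assms)
  finally show ?thesis .
qed

text \<open>The inclusion \<open>P \<subset> \<Lambda>\<close>.\<close>

definition to_laurent :: "'n poly_ring \<Rightarrow> 'n laurent_ring"
  where "to_laurent = map_exponents (Poly_Mapping.map int)"

lemma lookup_map_int [simp]: "Poly_Mapping.lookup (Poly_Mapping.map int m) i = int (Poly_Mapping.lookup m i)"
  by (simp add: Poly_Mapping.map.rep_eq when_def)

lemma map_int_add: "Poly_Mapping.map int (m + k) = Poly_Mapping.map int m + Poly_Mapping.map int k"
  by (rule poly_mapping_eqI) (simp add: lookup_add)

lemma to_laurent_add: "to_laurent (p + q) = to_laurent p + to_laurent q"
  by (simp add: to_laurent_def map_exponents_add)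

lemma to_laurent_mult: "to_laurent (p * q) = to_laurent p * to_laurent q"
  by (simp add: to_laurent_def map_exponents_mult map_int_add)

lemma to_laurent_single [simp]:
  "to_laurent (Poly_Mapping.single m c) = Poly_Mapping.single (Poly_Mapping.map int m) c"
  by (simp add: to_laurent_def)

lemma inj_to_laurent: "inj to_laurent"
proof (rule inj_on_inverseI)
  fix p :: "'n poly_ring"
  have "Poly_Mapping.map nat (Poly_Mapping.map int m) = m" for m :: "'n \<Rightarrow>\<^sub>0 nat"
    by (rule poly_mapping_eqI) (simp add: Poly_Mapping.map.rep_eq when_def)
  then show "map_exponents (Poly_Mapping.map nat) (to_laurent p) = p"
    by (simp add: to_laurent_def map_exponents_map_exponents map_exponents_id)
qed

definition involution :: "'n laurent_ring \<Rightarrow> 'n laurent_ring"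
  where "involution = map_exponents uminus"

lemma involution_add: "involution (f + g) = involution f + involution g"
  by (simp add: involution_def map_exponents_add)

lemma involution_mult: "involution (f * g) = involution f * involution g"
  by (simp add: involution_def map_exponents_mult)

lemma involution_const: "involution (Poly_Mapping.single 0 c) = Poly_Mapping.single 0 c"
  by (simp add: involution_def)

lemma involution_var:
  "involution (Poly_Mapping.single (Poly_Mapping.single i 1) 1) =
    Poly_Mapping.single (Poly_Mapping.single i (- 1)) 1"
  by (simp add: involution_def single_uminus)

definition deg_in :: "'n \<Rightarrow> 'n poly_ring \<Rightarrow> nat"
  where "deg_in i g = Max ((\<lambda>m. Poly_Mapping.lookup m i) ` Poly_Mapping.keys g)"

definition lvar :: "'n \<Rightarrow> 'n laurent_ring"
  where "lvar i = Poly_Mapping.single (Poly_Mapping.single i 1) 1"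

text \<open>\<open>involution (to_laurent g)\<close> is \<open>g(t\<^sub>1\<^sup>-\<^sup>1, \<dots>, t\<^sub>r\<^sup>-\<^sup>1)\<close>.\<close>

definition recip :: "'n::finite poly_ring \<Rightarrow> 'n poly_ring"
  where "recip g =
    (THE h. to_laurent h = (\<Prod>i\<in>UNIV. lvar i ^ deg_in i g) * involution (to_laurent g))"

lemma lvar_power: "lvar i ^ k = Poly_Mapping.single (Poly_Mapping.single i (int k)) 1"
  by (induction k) (simp_all add: lvar_def mult_single single_add)

lemma prod_single_one:
  "(\<Prod>i\<in>A. Poly_Mapping.single (f i) (1::rat)) = Poly_Mapping.single (\<Sum>i\<in>A. f i) 1"
  for f :: "'a \<Rightarrow> 'b::comm_monoid_add"
  by (induction A rule: infinite_finite_induct) (simp_all add: mult_single)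

lemma to_laurent_recip:
  fixes g :: "'n::finite poly_ring"
  shows "to_laurent (recip g) = (\<Prod>i\<in>UNIV. lvar i ^ deg_in i g) * involution (to_laurent g)"
proof -
  define d :: "'n \<Rightarrow>\<^sub>0 nat" where "d = (\<Sum>i\<in>UNIV. Poly_Mapping.single i (deg_in i g))"
  define D :: "'n \<Rightarrow>\<^sub>0 int" where "D = (\<Sum>i\<in>UNIV. Poly_Mapping.single i (int (deg_in i g)))"
  have d: "Poly_Mapping.lookup d i = deg_in i g" for i
    by (simp add: d_def lookup_sum lookup_single when_def)
  have D: "Poly_Mapping.lookup D i = int (deg_in i g)" for i
    by (simp add: D_def lookup_sum lookup_single when_def)
  have exps: "Poly_Mapping.map int (d - m) = D + - Poly_Mapping.map int m"
    if "m \<in> Poly_Mapping.keys g" for m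
  proof (rule poly_mapping_eqI)
    fix i
    have "Poly_Mapping.lookup m i \<le> deg_in i g"
      unfolding deg_in_def using that by (intro Max_ge) auto
    then show "Poly_Mapping.lookup (Poly_Mapping.map int (d - m)) i =
        Poly_Mapping.lookup (D + - Poly_Mapping.map int m) i"
      by (simp add: lookup_minus lookup_add d D of_nat_diff)
  qed
  have "(\<Prod>i\<in>UNIV. lvar i ^ deg_in i g) * involution (to_laurent g) =
      Poly_Mapping.single D 1 * map_exponents (\<lambda>m. - Poly_Mapping.map int m) g"
    by (simp add: lvar_power prod_single_one D_def involution_def to_laurent_def
        map_exponents_map_exponents)
  also have "\<dots> = to_laurent (map_exponents (\<lambda>m. d - m) g)"
    by (simp add: to_laurent_def map_exponents_map_exponents)
       (simp add: map_exponents_def sum_distrib_left mult_single exps)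
  finally have "\<exists>!h. to_laurent h = (\<Prod>i\<in>UNIV. lvar i ^ deg_in i g) * involution (to_laurent g)"
    using inj_to_laurent by (metis injD)
  then show ?thesis
    unfolding recip_def by (rule theI')
qed

text \<open>
  The library order on \<open>'n \<Rightarrow>\<^sub>0 nat\<close> compares exponent vectors at the smallest index where they
  differ: it is the lexicographic order in which smaller indices give larger variables.
\<close>

lemma less_exponent_iff:
  "m < k \<longleftrightarrow> (\<exists>i. Poly_Mapping.lookup m i < Poly_Mapping.lookup k i \<and>
    (\<forall>j<i. Poly_Mapping.lookup m j = Poly_Mapping.lookup k j))"
  for m k :: "'n::linorder \<Rightarrow>\<^sub>0 nat"
  by (simp add: less_poly_mapping.rep_eq less_fun_def)

definition lmon :: "'n::linorder poly_ring \<Rightarrow> ('n \<Rightarrow>\<^sub>0 nat)"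
  where "lmon p = Max (Poly_Mapping.keys p)"

definition lcoeff :: "'n::linorder poly_ring \<Rightarrow> rat"
  where "lcoeff p = Poly_Mapping.lookup p (lmon p)"

definition lterm :: "'n::linorder poly_ring \<Rightarrow> 'n poly_ring"
  where "lterm p = Poly_Mapping.single (lmon p) (lcoeff p)"

definition is_groebner_basis :: "'n::linorder poly_ring set \<Rightarrow> 'n poly_ring set \<Rightarrow> bool"
  where "is_groebner_basis G J \<longleftrightarrow>
    finite G \<and> G \<subseteq> J \<and> 0 \<notin> G \<and>
    ideal_generated (lterm ` G) = ideal_generated (lterm ` (J - {0}))"

definition is_reduced_groebner_basis :: "'n::linorder poly_ring set \<Rightarrow> 'n poly_ring set \<Rightarrow> bool"
  where "is_reduced_groebner_basis G J \<longleftrightarrow>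
    is_groebner_basis G J \<and>
    (\<forall>g\<in>G. lcoeff g = 1 \<and>
      (\<forall>m\<in>Poly_Mapping.keys g. Poly_Mapping.single m 1 \<notin> ideal_generated (lterm ` (G - {g}))))"

text \<open>One reduction step: a term of \<open>f\<close> divisible by the leading term of some \<open>g \<in> G\<close> is
  cancelled by subtracting a multiple of \<open>g\<close>.\<close>

definition reduces :: "'n::linorder poly_ring set \<Rightarrow> 'n poly_ring \<Rightarrow> 'n poly_ring \<Rightarrow> bool"
  where "reduces G f h \<longleftrightarrow>
    (\<exists>g\<in>G - {0}. \<exists>k. k + lmon g \<in> Poly_Mapping.keys f \<and>
      h = f - Poly_Mapping.single k (Poly_Mapping.lookup f (k + lmon g) / lcoeff g) * g)"

text \<open>The normal form is well defined when \<open>G\<close> is a Groebner basis.\<close>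

definition normal_form :: "'n::linorder poly_ring set \<Rightarrow> 'n poly_ring \<Rightarrow> 'n poly_ring"
  where "normal_form G f = (THE h. (reduces G)\<^sup>*\<^sup>* f h \<and> (\<nexists>h'. reduces G h h'))"

end

theory Submission
  imports Defs "HOL-Library.Multiset"
begin

text \<open>
  Every monomial is a unit of \<open>\<Lambda>\<close>. Hence \<open>E\<close> is determined by \<open>J\<close> (clearing denominators moves
  an element of \<open>E\<close> into \<open>J\<close>), and \<open>recip g\<close> agrees with the involution of \<open>g\<close> up to a unit, so that
  \<open>recip g \<in> J\<close> says precisely that the involution maps \<open>g\<close> into \<open>E\<close> (\<open>recip_mem_contraction_iff\<close>).
  As the involution is a ring homomorphism, the polynomials that it maps into \<open>E\<close> form an ideal of \<open>P\<close>.
  If this ideal contains \<open>G\<close>, then it contains the ideal \<open>J\<close> generated by \<open>G\<close>, and clearing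
  denominators shows that the involution maps \<open>E\<close> into itself. Being its own inverse, it then maps
  \<open>E\<close> onto itself.

  The remaining ingredients are the standard facts on division by a Groebner basis \<open>G\<close> of an ideal
  \<open>J\<close>. Reduction terminates because it replaces a monomial by smaller ones and the lexicographic order is
  well-founded (\<open>reduction_terminates\<close>). A nonzero element of \<open>J\<close> is always reducible at its leading
  monomial, so \<open>0\<close> is the only irreducible element of \<open>J\<close>
  (\<open>irreducible_in_ideal_is_zero\<close>). It follows that \<open>G\<close> generates \<open>J\<close>
  and, applied to the difference of two irreducible remainders, that normal forms are unique; a polynomial is
  in \<open>J\<close> iff its normal form is \<open>0\<close> (\<open>normal_form_eq_0_iff\<close>).
\<close>

section \<open>Well-foundedness of the lexicographic order\<close>

text \<open>Listing the exponents from the smallest index on turns this order into the lexicographic order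
  on lists of a fixed length, which is well-founded. Without the bound on the length it would not be.\<close>

lemma wf_less_exponent: "wf {(m, k :: 'n::{finite,linorder} \<Rightarrow>\<^sub>0 nat). m < k}"
proof -
  define xs :: "'n list" where "xs = sorted_list_of_set UNIV"
  define L where "L m = map (Poly_Mapping.lookup m) xs" for m :: "'n \<Rightarrow>\<^sub>0 nat"
  have "(L m, L k) \<in> lex less_than" if "m < k" for m k
  proof -
    from that obtain i where i: "Poly_Mapping.lookup m i < Poly_Mapping.lookup k i"
      and eq: "\<And>j. j < i \<Longrightarrow> Poly_Mapping.lookup m j = Poly_Mapping.lookup k j"
      by (auto simp: less_exponent_iff)
    have "i \<in> set xs" by (simp add: xs_def)
    then obtain ys zs where xs: "xs = ys @ i # zs" by (meson split_list)
    have "sorted_wrt (<) xs" by (simp add: xs_def)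
    then have "\<And>j. j \<in> set ys \<Longrightarrow> j < i" by (simp add: xs sorted_wrt_append)
    then have "map (Poly_Mapping.lookup m) ys = map (Poly_Mapping.lookup k) ys"
      by (simp add: eq)
    then have "L m = map (Poly_Mapping.lookup m) ys @ Poly_Mapping.lookup m i # map (Poly_Mapping.lookup m) zs"
      and "L k = map (Poly_Mapping.lookup m) ys @ Poly_Mapping.lookup k i # map (Poly_Mapping.lookup k) zs"
      by (simp_all add: L_def xs)
    moreover have "length (L m) = length (L k)" by (simp add: L_def)
    ultimately show ?thesis
      using i unfolding lex_conv mem_Collect_eq prod.case less_than_iff by metis
  qed
  then have "{(m, k). m < k} \<subseteq> inv_image (lex less_than) L" by auto
  moreover have "wf (inv_image (lex less_than) L)" by auto
  ultimately show ?thesis by (rule wf_subset[rotated])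
qed

section \<open>Reduction terminates\<close>

lemma lmon_in_keys: "p \<noteq> 0 \<Longrightarrow> lmon p \<in> Poly_Mapping.keys p"
  unfolding lmon_def by (rule Max_in) auto

lemma key_le_lmon: "m \<in> Poly_Mapping.keys p \<Longrightarrow> m \<le> lmon p"
  unfolding lmon_def by (rule Max_ge) auto

lemma lcoeff_nonzero: "p \<noteq> 0 \<Longrightarrow> lcoeff p \<noteq> 0"
  unfolding lcoeff_def using lmon_in_keys by (auto simp: in_keys_iff)

lemma lookup_single_mult:
  fixes g :: "'a::cancel_comm_monoid_add \<Rightarrow>\<^sub>0 'b::semiring_0"
  shows "Poly_Mapping.lookup (Poly_Mapping.single k c * g) (k + m) = c * Poly_Mapping.lookup g m"
proof -
  have "Poly_Mapping.single k c * g =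
      (\<Sum>n\<in>Poly_Mapping.keys g. Poly_Mapping.single (k + n) (c * Poly_Mapping.lookup g n))"
    by (subst map_exponents_id[of g, symmetric])
       (simp add: map_exponents_def sum_distrib_left mult_single)
  then show ?thesis
    by (auto simp: lookup_sum lookup_single when_def in_keys_iff)
qed

text \<open>A step removes one monomial \<open>\<mu>\<close> and introduces only smaller ones, so the sets of monomials
  decrease in the multiset extension of the order.\<close>

lemma reduction_terminates: "wf {(h, f). reduces (G :: 'n::{finite,linorder} poly_ring set) f h}"
proof -
  let ?r = "{(m, k :: 'n \<Rightarrow>\<^sub>0 nat). m < k}"
  define M where "M f = mset_set (Poly_Mapping.keys f)" for f :: "'n poly_ring"
  have "(M h, M f) \<in> mult ?r" if "reduces G f h" for f h
  proof -
    from that obtain g k where g: "g \<noteq> 0" and mu: "k + lmon g \<in> Poly_Mapping.keys f"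
      and h: "h = f - Poly_Mapping.single k (Poly_Mapping.lookup f (k + lmon g) / lcoeff g) * g"
      by (auto simp: reduces_def)
    let ?\<mu> = "k + lmon g"
    let ?F = "Poly_Mapping.keys f" and ?H = "Poly_Mapping.keys h"
    have "Poly_Mapping.lookup h ?\<mu> = 0"
      using lcoeff_nonzero[OF g] by (simp add: h lookup_minus lookup_single_mult lcoeff_def)
    then have mu_h: "?\<mu> \<notin> ?H" by (simp add: in_keys_iff)
    have new: "x < ?\<mu>" if "x \<in> ?H - ?F" for x
    proof -
      have "x \<in> Poly_Mapping.keys
          (Poly_Mapping.single k (Poly_Mapping.lookup f (k + lmon g) / lcoeff g) * g)"
        using that by (auto simp: in_keys_iff h lookup_minus)
      then obtain n where n: "n \<in> Poly_Mapping.keys g" and x: "x = k + n"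
        using keys_mult by (fastforce split: if_splits)
      have "x \<le> ?\<mu>" using key_le_lmon[OF n] by (simp add: x add_left_mono)
      moreover have "x \<noteq> ?\<mu>" using that mu_h by auto
      ultimately show ?thesis by simp
    qed
    have split: "mset_set A = mset_set (A \<inter> B) + mset_set (A - B)" if "finite A"
      for A B :: "('n \<Rightarrow>\<^sub>0 nat) set"
      using that by (subst mset_set_Union[symmetric]) (auto simp: Int_Diff_Un)
    have "(mset_set (?H \<inter> ?F) + mset_set (?H - ?F), mset_set (?H \<inter> ?F) + mset_set (?F - ?H)) \<in> mult ?r"
    proof (rule one_step_implies_mult)
      show "mset_set (?F - ?H) \<noteq> {#}" using mu mu_h by (auto simp: mset_set_empty_iff)
      show "\<forall>x\<in>#mset_set (?H - ?F). \<exists>y\<in>#mset_set (?F - ?H). (x, y) \<in> ?r"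
        using mu mu_h new by (intro ballI bexI[of _ ?\<mu>]) auto
    qed
    then show ?thesis
      using split[of ?H ?F] split[of ?F ?H] by (simp add: M_def Int_commute)
  qed
  then have "{(h, f). reduces G f h} \<subseteq> inv_image (mult ?r) M" by auto
  moreover have "wf (inv_image (mult ?r) M)"
    by (intro wf_inv_image wf_mult wf_less_exponent)
  ultimately show ?thesis by (rule wf_subset[rotated])
qed

definition irreducible_wrt :: "'n::linorder poly_ring set \<Rightarrow> 'n poly_ring \<Rightarrow> bool"
  where "irreducible_wrt G h \<longleftrightarrow> (\<nexists>h'. reduces G h h')"

lemma irreducible_wrt_iff:
  "irreducible_wrt G h \<longleftrightarrow> (\<forall>g\<in>G - {0}. \<forall>k. k + lmon g \<notin> Poly_Mapping.keys h)"
  by (auto simp: irreducible_wrt_def reduces_def)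

lemma irreducible_reduct_exists:
  fixes f :: "'n::{finite,linorder} poly_ring"
  shows "\<exists>h. (reduces G)\<^sup>*\<^sup>* f h \<and> irreducible_wrt G h"
proof (induction f rule: wf_induct_rule[OF reduction_terminates[of G]])
  case (1 f)
  then show ?case
    by (cases "irreducible_wrt G f")
       (auto simp: irreducible_wrt_def[of G f] intro: converse_rtranclp_into_rtranclp)
qed

lemma reduct_congruent:
  assumes "(reduces G)\<^sup>*\<^sup>* f h"
  shows "f - h \<in> ideal_generated G"
  using assms
proof (induction rule: rtranclp_induct)
  case base
  then show ?case by (simp add: ring_ideal.span_zero)
next
  case (step h h')
  then obtain g c where "g \<in> G" and h': "h' = h - c * g" by (auto simp: reduces_def)
  then have "c * g \<in> ideal_generated G"
    by (intro ring_ideal.span_scale ring_ideal.span_base)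
  from ring_ideal.span_add[OF step.IH this] show ?case by (simp add: h' algebra_simps)
qed

section \<open>Groebner bases decide ideal membership\<close>

text \<open>A sum of multiples of terms involves only multiples of their monomials.\<close>

lemma key_of_monomial_ideal:
  assumes "p \<in> ideal_generated (lterm ` G)" "m \<in> Poly_Mapping.keys p"
  shows "\<exists>g\<in>G. \<exists>k. m = k + lmon g"
proof -
  let ?S = "{p. \<forall>m\<in>Poly_Mapping.keys p. \<exists>g\<in>G. \<exists>k. m = k + lmon g}"
  have "is_ideal ?S"
  proof (rule ring_ideal.subspaceI)
    show "0 \<in> ?S" by simp
    show "p + q \<in> ?S" if "p \<in> ?S" "q \<in> ?S" for p q
      using that keys_add[of p q] by blast
    show "c * p \<in> ?S" if "p \<in> ?S" for c p
    proof -
      have "\<exists>g\<in>G. \<exists>k. m = k + lmon g" if m: "m \<in> Poly_Mapping.keys (c * p)" for m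
      proof -
        from m keys_mult[of c p] obtain a b where "m = a + b" "b \<in> Poly_Mapping.keys p" by blast
        moreover from this \<open>p \<in> ?S\<close> obtain g k where "g \<in> G" "b = k + lmon g" by blast
        ultimately have "m = (a + k) + lmon g" by (simp add: add.assoc)
        with \<open>g \<in> G\<close> show ?thesis by blast
      qed
      then show ?thesis by blast
    qed
  qed
  moreover have "lterm ` G \<subseteq> ?S"
    by (auto simp: lterm_def split: if_splits intro!: bexI exI[of _ 0])
  ultimately show ?thesis
    using assms ring_ideal.span_minimal[of "lterm ` G" ?S] by blast
qed

lemma groebner_basis_divides_lmon:
  assumes "is_groebner_basis G J" "f \<in> J" "f \<noteq> 0"
  shows "\<exists>g\<in>G. \<exists>k. lmon f = k + lmon g"
proof (rule key_of_monomial_ideal)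
  show "lterm f \<in> ideal_generated (lterm ` G)"
    using assms by (auto simp: is_groebner_basis_def intro!: ring_ideal.span_base)
  show "lmon f \<in> Poly_Mapping.keys (lterm f)"
    using lcoeff_nonzero[OF \<open>f \<noteq> 0\<close>] by (simp add: lterm_def)
qed

lemma irreducible_in_ideal_is_zero:
  assumes "is_groebner_basis G J" "h \<in> J" "irreducible_wrt G h"
  shows "h = 0"
proof (rule ccontr)
  assume "h \<noteq> 0"
  then obtain g k where "g \<in> G" "lmon h = k + lmon g"
    using groebner_basis_divides_lmon assms by blast
  moreover have "g \<noteq> 0" using \<open>g \<in> G\<close> assms(1) by (auto simp: is_groebner_basis_def)
  ultimately show False
    using lmon_in_keys[OF \<open>h \<noteq> 0\<close>] assms(3) by (force simp: irreducible_wrt_iff)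
qed

lemma irreducible_wrt_diff:
  assumes "irreducible_wrt G h" "irreducible_wrt G h'"
  shows "irreducible_wrt G (h - h')"
  using assms by (auto simp: irreducible_wrt_iff in_keys_iff lookup_minus)

context
  fixes G J :: "'n::{finite,linorder} poly_ring set"
  assumes ideal: "is_ideal J" and groebner: "is_groebner_basis G J"
begin

lemma span_groebner_basis_subset: "ideal_generated G \<subseteq> J"
  using groebner ideal by (intro ring_ideal.span_minimal) (auto simp: is_groebner_basis_def)

lemma reduct_mem_iff:
  assumes "(reduces G)\<^sup>*\<^sup>* f h"
  shows "f \<in> J \<longleftrightarrow> h \<in> J"
proof -
  have d: "f - h \<in> J" using reduct_congruent[OF assms] span_groebner_basis_subset by blast
  show ?thesis
    using ring_ideal.subspace_add[OF ideal d, of h] ring_ideal.subspace_diff[OF ideal _ d, of f]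
    by auto
qed

lemma groebner_basis_generates: "ideal_generated G = J"
proof
  show "J \<subseteq> ideal_generated G"
  proof
    fix f assume "f \<in> J"
    obtain h where h: "(reduces G)\<^sup>*\<^sup>* f h" "irreducible_wrt G h"
      using irreducible_reduct_exists by blast
    with \<open>f \<in> J\<close> have "h = 0"
      using irreducible_in_ideal_is_zero[OF groebner] reduct_mem_iff by blast
    with reduct_congruent[OF h(1)] show "f \<in> ideal_generated G" by simp
  qed
qed (rule span_groebner_basis_subset)

text \<open>Two irreducible remainders of \<open>f\<close> differ by an irreducible element of \<open>J\<close>.\<close>

lemma irreducible_reduct_unique:
  assumes "(reduces G)\<^sup>*\<^sup>* f h" "irreducible_wrt G h" "(reduces G)\<^sup>*\<^sup>* f h'" "irreducible_wrt G h'"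
  shows "h = h'"
proof -
  have "(f - h') - (f - h) \<in> ideal_generated G"
    by (intro ring_ideal.span_diff reduct_congruent assms)
  then have "h - h' \<in> J" using span_groebner_basis_subset by (auto simp: algebra_simps)
  then have "h - h' = 0"
    using irreducible_in_ideal_is_zero[OF groebner] irreducible_wrt_diff assms by blast
  then show ?thesis by simp
qed

lemma normal_form_irreducible_reduct:
  "(reduces G)\<^sup>*\<^sup>* f (normal_form G f) \<and> irreducible_wrt G (normal_form G f)"
  unfolding normal_form_def irreducible_wrt_def
  by (rule theI')
     (use irreducible_reduct_exists[of G f] irreducible_reduct_unique in
        \<open>auto simp: irreducible_wrt_def\<close>)

lemma normal_form_eq_0_iff: "normal_form G f = 0 \<longleftrightarrow> f \<in> J"
proof
  assume "normal_form G f = 0"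
  then show "f \<in> J"
    using normal_form_irreducible_reduct[of f] reduct_mem_iff ring_ideal.subspace_0[OF ideal] by metis
next
  assume "f \<in> J"
  then show "normal_form G f = 0"
    using normal_form_irreducible_reduct reduct_mem_iff irreducible_in_ideal_is_zero[OF groebner]
    by blast
qed

end

section \<open>Contraction to polynomials and the involution\<close>

lemma involution_involution [simp]: "involution (involution f) = f"
  by (simp add: involution_def map_exponents_map_exponents map_exponents_id)

lemma is_ideal_ring_hom_preimage:
  fixes \<phi> :: "'a::comm_ring_1 \<Rightarrow> 'b::comm_ring_1"
  assumes "\<And>p q. \<phi> (p + q) = \<phi> p + \<phi> q" "\<And>p q. \<phi> (p * q) = \<phi> p * \<phi> q" "is_ideal E"
  shows "is_ideal {p. \<phi> p \<in> E}"
proof -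
  have "\<phi> 0 = 0" using assms(1)[of 0 0] by simp
  with assms show ?thesis by (simp add: ring_ideal.subspace_def)
qed

lemma monomial_mult_mem_iff:
  fixes E :: "'n laurent_ring set"
  assumes "is_ideal E"
  shows "Poly_Mapping.single m 1 * f \<in> E \<longleftrightarrow> f \<in> E"
proof
  assume "Poly_Mapping.single m 1 * f \<in> E"
  then have "Poly_Mapping.single (- m) 1 * (Poly_Mapping.single m 1 * f) \<in> E"
    by (rule ring_ideal.subspace_scale[OF assms])
  then show "f \<in> E"
    by (simp add: mult.assoc[symmetric] mult_single)
qed (rule ring_ideal.subspace_scale[OF assms])

lemma recip_mem_contraction_iff:
  fixes E :: "'n::finite laurent_ring set"
  assumes "is_ideal E"
  shows "to_laurent (recip g) \<in> E \<longleftrightarrow> involution (to_laurent g) \<in> E"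
  by (simp add: to_laurent_recip lvar_power prod_single_one monomial_mult_mem_iff[OF assms])

text \<open>The exponent of the denominator only has to dominate all negative exponents of \<open>f\<close>; the sum
  of their absolute values does so without a choice of maxima.\<close>

lemma clear_denominators:
  fixes f :: "'n::finite laurent_ring"
  obtains d p where "Poly_Mapping.single d 1 * f = to_laurent p"
proof -
  define d :: "'n \<Rightarrow>\<^sub>0 int" where
    "d = (\<Sum>i\<in>UNIV. Poly_Mapping.single i (\<Sum>m\<in>Poly_Mapping.keys f. \<bar>Poly_Mapping.lookup m i\<bar>))"
  have d: "Poly_Mapping.lookup d i = (\<Sum>m\<in>Poly_Mapping.keys f. \<bar>Poly_Mapping.lookup m i\<bar>)" for i
    by (simp add: d_def lookup_sum lookup_single when_def)
  have exps: "Poly_Mapping.map int (Poly_Mapping.map nat (d + m)) = d + m"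
    if "m \<in> Poly_Mapping.keys f" for m
  proof (rule poly_mapping_eqI)
    fix i
    have "\<bar>Poly_Mapping.lookup m i\<bar> \<le> Poly_Mapping.lookup d i"
      unfolding d using that by (intro member_le_sum) auto
    then show "Poly_Mapping.lookup (Poly_Mapping.map int (Poly_Mapping.map nat (d + m))) i =
        Poly_Mapping.lookup (d + m) i"
      by (auto simp: Poly_Mapping.map.rep_eq lookup_add when_def)
  qed
  have "to_laurent (map_exponents (\<lambda>m. Poly_Mapping.map nat (d + m)) f) =
      (\<Sum>m\<in>Poly_Mapping.keys f. Poly_Mapping.single (d + m) (Poly_Mapping.lookup f m))"
    by (simp add: to_laurent_def map_exponents_map_exponents)
       (simp add: map_exponents_def exps)
  also have "\<dots> = Poly_Mapping.single d 1 * map_exponents (\<lambda>m. m) f"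
    by (simp add: map_exponents_def sum_distrib_left mult_single)
  finally show thesis
    using that by (metis map_exponents_id)
qed

text \<open>Stability of \<open>E\<close> can be tested on any generators of its contraction to \<open>P\<close>, because
  the contraction generates \<open>E\<close> up to units.\<close>

lemma involution_image_eq_iff:
  fixes E :: "'n::finite laurent_ring set"
  assumes E: "is_ideal E" and G: "ideal_generated G = {p. to_laurent p \<in> E}"
  shows "involution ` E = E \<longleftrightarrow> (\<forall>g\<in>G. involution (to_laurent g) \<in> E)"
proof
  assume stable: "involution ` E = E"
  show "\<forall>g\<in>G. involution (to_laurent g) \<in> E"
  proof
    fix g assume "g \<in> G"
    then have "to_laurent g \<in> E" using G ring_ideal.span_base by blast
    then show "involution (to_laurent g) \<in> E" using stable by blast
  qed
next
  assume gens: "\<forall>g\<in>G. involution (to_laurent g) \<in> E"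
  have "is_ideal {p. involution (to_laurent p) \<in> E}"
    by (intro is_ideal_ring_hom_preimage E)
       (simp_all add: involution_add involution_mult to_laurent_add to_laurent_mult)
  with gens have sub: "ideal_generated G \<subseteq> {p. involution (to_laurent p) \<in> E}"
    by (intro ring_ideal.span_minimal) auto
  have into: "involution f \<in> E" if "f \<in> E" for f
  proof -
    obtain d p where p: "Poly_Mapping.single d 1 * f = to_laurent p"
      by (rule clear_denominators)
    have "to_laurent p \<in> E"
      using that by (simp add: p[symmetric] monomial_mult_mem_iff[OF E])
    then have "involution (Poly_Mapping.single d 1 * f) \<in> E"
      using sub G by (auto simp: p)
    moreover have "involution (Poly_Mapping.single d 1 * f) = Poly_Mapping.single (- d) 1 * involution f"
      by (simp add: involution_mult) (simp add: involution_def)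
    ultimately show ?thesis by (simp add: monomial_mult_mem_iff[OF E])
  qed
  show "involution ` E = E"
  proof
    show "involution ` E \<subseteq> E" using into by blast
    show "E \<subseteq> involution ` E"
    proof
      fix f assume "f \<in> E"
      then show "f \<in> involution ` E"
        using into by (intro image_eqI[of _ _ "involution f"]) auto
    qed
  qed
qed

theorem proposition5p5:
  fixes E :: "'n::{finite,linorder} laurent_ring set"
    and J G :: "'n poly_ring set"
  assumes "is_ideal E"
    and "J = {p. to_laurent p \<in> E}"
    and "is_reduced_groebner_basis G J"
  shows "(involution ` E = E \<longleftrightarrow> (\<forall>g\<in>G. recip g \<in> J)) \<and>
    ((\<forall>g\<in>G. recip g \<in> J) \<longleftrightarrow> (\<forall>g\<in>G. normal_form G (recip g) = 0))"
proof -
  have J: "is_ideal J"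
    unfolding assms(2) by (intro is_ideal_ring_hom_preimage to_laurent_add to_laurent_mult assms(1))
  have G: "is_groebner_basis G J" using assms(3) by (simp add: is_reduced_groebner_basis_def)
  have recip: "recip g \<in> J \<longleftrightarrow> involution (to_laurent g) \<in> E" for g
    using recip_mem_contraction_iff[OF assms(1)] by (simp add: assms(2))
  have "ideal_generated G = {p. to_laurent p \<in> E}"
    using groebner_basis_generates[OF J G] assms(2) by simp
  from involution_image_eq_iff[OF assms(1) this] show ?thesis
    by (simp add: recip normal_form_eq_0_iff[OF J G])
qed

end
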